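(* $\mathcal{QC}\subset\mathcal{T}^\pi_2$; that is, every quadratic cardioid distribution $QC(\mu_1,\mu_2,r_1,r_2)$, with $\mu_1\le\mu_2$ in $[0,2\pi)$ and $r_1,r_2\ge0$, is a Borel probability measure on the circle whose Fourier coefficients of index $n$ vanish for all integers $n$ with $|n|>2$.
   Context: For $\mu_1\le\mu_2$ in $[0,2\pi)$ and $r_1,r_2\ge 0$, the quadratic cardioid distribution $QC(\mu_1,\mu_2,r_1,r_2)$ is the distribution on the circle $\mathbb{S}^1=\mathbb{R}/2\pi\mathbb{Z}$ with density (with respect to $d\theta$) $$f(\theta)=\frac{1}{2\pi(1+r_1^2+r_2^2)}\Big(1+r_1^2+r_2^2+2r_1\cos(\theta-\mu_1)+2r_2\cos(\theta-\mu_2)+2r_1r_2\cos(2\theta-\mu_1-\mu_2)\Big).$$ $\mathcal{QC}$ denotes the set of all such distributions. $\mathcal{T}^\pi_2$ denotes the set of all Borel probability measures $\nu$ on $\mathbb{S}^1$ whose Fourier coefficients satisfy $\hat\nu(n)=0$ for all $n\notin\{-2,-1,0,1,2\}$. *)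

theory Defs
  imports "HOL-Probability.Probability"
begin

definition cong_2pi :: "real \<Rightarrow> real \<Rightarrow> bool" where
  "cong_2pi x y \<longleftrightarrow> (\<exists>k::int. x - y = 2 * pi * of_int k)"

lemma equivp_cong_2pi: "equivp cong_2pi"
proof (rule equivpI)
  show "reflp cong_2pi"
    unfolding reflp_def cong_2pi_def by (auto intro: exI[of _ 0])
  show "symp cong_2pi"
    unfolding symp_def cong_2pi_def
  proof (intro allI impI)
    fix x y :: real assume "\<exists>k::int. x - y = 2 * pi * of_int k"
    then obtain k :: int where "x - y = 2 * pi * of_int k" by blast
    then have "y - x = 2 * pi * of_int (- k)" by simp
    then show "\<exists>k::int. y - x = 2 * pi * of_int k" by blast
  qed
  show "transp cong_2pi"
    unfolding transp_def cong_2pi_def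
  proof (intro allI impI)
    fix x y z :: real
    assume "\<exists>k::int. x - y = 2 * pi * of_int k" "\<exists>k::int. y - z = 2 * pi * of_int k"
    then obtain k l :: int
      where "x - y = 2 * pi * of_int k" "y - z = 2 * pi * of_int l" by blast
    then have "x - z = 2 * pi * of_int (k + l)" by (simp add: algebra_simps)
    then show "\<exists>k::int. x - z = 2 * pi * of_int k" by blast
  qed
qed

quotient_type circle = real / cong_2pi
  by (rule equivp_cong_2pi)

text \<open>The circle carries the quotient topology of the projection \<open>abs_circle\<close>.\<close>

instantiation circle :: topological_space
begin

definition open_circle :: "circle set \<Rightarrow> bool" where
  "open_circle U \<longleftrightarrow> open (abs_circle -` U)"

instance
proof
  show "open (UNIV :: circle set)"
    by (simp add: open_circle_def)
  show "open (S \<inter> T)" if "open S" "open T" for S T :: "circle set"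
    using that by (simp add: open_circle_def vimage_Int open_Int)
  show "open (\<Union>K)" if "\<forall>S\<in>K. open S" for K :: "circle set set"
    using that by (auto simp: open_circle_def vimage_Union intro!: open_UN)
qed

end

text \<open>The measure \<open>d\<theta>\<close> on the circle, of total mass \<open>2\<pi>\<close>.\<close>

definition circle_dtheta :: "circle measure" where
  "circle_dtheta = distr (restrict_space lborel {0..<2 * pi}) borel abs_circle"

lemma cos_cong_2pi: "cos (x + 2 * pi * of_int k) = cos x"
  by (simp add: cos_add)

lemma sin_cong_2pi: "sin (x + 2 * pi * of_int k) = sin x"
  by (simp add: sin_add)

lift_definition circle_char :: "int \<Rightarrow> circle \<Rightarrow> complex" is
  "\<lambda>n \<theta>. exp (\<i> * of_int n * complex_of_real \<theta>)"
proof -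
  fix n :: int and x y :: real
  assume "cong_2pi x y"
  then obtain k :: int where "x = y + 2 * pi * of_int k"
    unfolding cong_2pi_def by (metis diff_add_cancel add.commute)
  then have eq: "of_int n * x = of_int n * y + 2 * pi * of_int (n * k)"
    by (simp add: algebra_simps)
  have exp_cis: "exp (\<i> * of_int n * complex_of_real t) = cis (of_int n * t)" for t
    by (simp add: cis_conv_exp mult.assoc)
  show "exp (\<i> * of_int n * complex_of_real x) = exp (\<i> * of_int n * complex_of_real y)"
    unfolding exp_cis eq complex_eq_iff by (simp only: cis.simps cos_cong_2pi sin_cong_2pi)
qed

definition fourier_coeff :: "circle measure \<Rightarrow> int \<Rightarrow> complex" where
  "fourier_coeff \<nu> n = (LINT x|\<nu>. circle_char (- n) x)"

definition qc_pdf :: "real \<Rightarrow> real \<Rightarrow> real \<Rightarrow> real \<Rightarrow> real \<Rightarrow> real" where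
  "qc_pdf \<mu>1 \<mu>2 r1 r2 \<theta> =
     1 / (2 * pi * (1 + r1\<^sup>2 + r2\<^sup>2)) *
     (1 + r1\<^sup>2 + r2\<^sup>2 + 2 * r1 * cos (\<theta> - \<mu>1) + 2 * r2 * cos (\<theta> - \<mu>2)
      + 2 * r1 * r2 * cos (2 * \<theta> - \<mu>1 - \<mu>2))"

lift_definition qc_density :: "real \<Rightarrow> real \<Rightarrow> real \<Rightarrow> real \<Rightarrow> circle \<Rightarrow> real" is qc_pdf
proof -
  fix \<mu>1 \<mu>2 r1 r2 x y :: real
  assume "cong_2pi x y"
  then obtain k :: int where k: "x = y + 2 * pi * of_int k"
    unfolding cong_2pi_def by (metis diff_add_cancel add.commute)
  have "cos (x - \<mu>) = cos (y - \<mu>)" for \<mu>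
    using cos_cong_2pi[of "y - \<mu>" k] by (simp add: k algebra_simps)
  moreover have "cos (2 * x - \<mu>1 - \<mu>2) = cos (2 * y - \<mu>1 - \<mu>2)"
    using cos_cong_2pi[of "2 * y - \<mu>1 - \<mu>2" "2 * k"] by (simp add: k algebra_simps)
  ultimately show "qc_pdf \<mu>1 \<mu>2 r1 r2 x = qc_pdf \<mu>1 \<mu>2 r1 r2 y"
    by (simp only: qc_pdf_def)
qed

text \<open>
  The bracket in the density is
  \<open>\<bar>1 + r1 exp (\<i>(\<theta> - \<mu>1)) + r2 exp (- \<i>(\<theta> - \<mu>2))\<bar>\<^sup>2\<close>,
  so \<open>ennreal\<close> never truncates a negative value here.
\<close>

definition quadratic_cardioid :: "real \<Rightarrow> real \<Rightarrow> real \<Rightarrow> real \<Rightarrow> circle measure" where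
  "quadratic_cardioid \<mu>1 \<mu>2 r1 r2 =
     density circle_dtheta (\<lambda>x. ennreal (qc_density \<mu>1 \<mu>2 r1 r2 x))"

definition QC :: "circle measure set" where
  "QC = {quadratic_cardioid \<mu>1 \<mu>2 r1 r2 | \<mu>1 \<mu>2 r1 r2.
           \<mu>1 \<in> {0..<2 * pi} \<and> \<mu>2 \<in> {0..<2 * pi} \<and> \<mu>1 \<le> \<mu>2 \<and> 0 \<le> r1 \<and> 0 \<le> r2}"

definition T2 :: "circle measure set" where
  "T2 = {\<nu>. sets \<nu> = sets borel \<and> prob_space \<nu> \<and>
            (\<forall>n::int. n \<notin> {-2, -1, 0, 1, 2} \<longrightarrow> fourier_coeff \<nu> n = 0)}"

end

theory Submission
  imports Defs
begin

text \<open>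
  The density is a trigonometric polynomial with frequencies in \<open>{-2..2}\<close> and constant term \<open>1 / 2\<pi>\<close>,
  nonnegative because it is a positive multiple of
  \<open>\<bar>1 + r1 exp (\<i>(\<theta> - \<mu>1)) + r2 exp (- \<i>(\<theta> - \<mu>2))\<bar>\<^sup>2\<close>.
  Orthogonality of the characters gives both the total mass and the vanishing coefficients.
\<close>

text \<open>By definition of the quotient topology, a set is open iff its preimage under
  \<open>abs_circle\<close> is. A function on the circle is therefore continuous as soon as its lift
  to the reals is, and continuity gives measurability.\<close>

lemma borel_measurable_circle:
  fixes f :: "circle \<Rightarrow> 'b::topological_space"
  assumes "continuous_on UNIV (\<lambda>\<theta>. f (abs_circle \<theta>))"
  shows "f \<in> borel_measurable borel"
proof (rule borel_measurable_continuous_onI)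
  have "open (f -` V)" if "open V" for V
    using open_vimage[OF that assms] by (simp add: open_circle_def vimage_def)
  then show "continuous_on UNIV f"
    by (simp add: continuous_on_open_vimage)
qed

lemma abs_circle_measurable [measurable]: "abs_circle \<in> borel \<rightarrow>\<^sub>M borel"
  by (rule borel_measurable_continuous_onI)
     (simp add: continuous_on_open_vimage flip: open_circle_def)

lemma circle_char_abs: "circle_char n (abs_circle \<theta>) = cis (of_int n * \<theta>)"
  by (simp add: circle_char.abs_eq cis_conv_exp mult.assoc)

lemma qc_normalizer_pos: "0 < 1 + r1\<^sup>2 + (r2\<^sup>2 :: real)"
  by (simp add: add_pos_nonneg)

lemma qc_density_measurable [measurable]: "qc_density \<mu>1 \<mu>2 r1 r2 \<in> borel_measurable borel"
  by (rule borel_measurable_circle)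
     (auto simp: qc_density.abs_eq qc_pdf_def less_imp_neq[OF qc_normalizer_pos, symmetric]
       intro!: continuous_intros)

lemma circle_char_measurable [measurable]: "circle_char n \<in> borel_measurable borel"
  by (rule borel_measurable_circle) (auto simp: circle_char_abs intro!: continuous_intros)

lemma qc_pdf_nonneg: "0 \<le> qc_pdf \<mu>1 \<mu>2 r1 r2 \<theta>"
proof -
  \<comment> \<open>The two squares are those of the real and imaginary parts of
    \<open>1 + r1 * exp (i a) + r2 * exp (- i b)\<close>; the opposite signs of the angles make the
    cross term \<open>cos (a + b)\<close>.\<close>
  have "1 + r1\<^sup>2 + r2\<^sup>2 + 2 * r1 * cos a + 2 * r2 * cos b + 2 * r1 * r2 * cos (a + b)
        = (1 + r1 * cos a + r2 * cos b)\<^sup>2 + (r1 * sin a - r2 * sin b)\<^sup>2" for a b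
  proof -
    have s: "(sin a)\<^sup>2 = 1 - (cos a)\<^sup>2" "(sin b)\<^sup>2 = 1 - (cos b)\<^sup>2"
      by (simp_all add: sin_squared_eq)
    show ?thesis
      unfolding power2_sum power2_diff power_mult_distrib s cos_add
      by (simp add: algebra_simps)
  qed
  from this[of "\<theta> - \<mu>1" "\<theta> - \<mu>2"]
  have "0 \<le> 1 + r1\<^sup>2 + r2\<^sup>2 + 2 * r1 * cos (\<theta> - \<mu>1) + 2 * r2 * cos (\<theta> - \<mu>2)
      + 2 * r1 * r2 * cos (2 * \<theta> - \<mu>1 - \<mu>2)"
    by (simp add: algebra_simps)
  then show ?thesis
    unfolding qc_pdf_def using qc_normalizer_pos[of r1 r2] by simp
qed

text \<open>Orthogonality of the characters: for \<open>m \<noteq> 0\<close> the antiderivative is 2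
  pi-periodic, so its increment over a full period vanishes; for \<open>m = 0\<close> the integrand
  is 1.\<close>

lemma has_bochner_integral_cis:
  "has_bochner_integral (restrict_space lborel {0..<2 * pi}) (\<lambda>\<theta>. cis (of_int m * \<theta>))
     (if m = 0 then complex_of_real (2 * pi) else 0)"
proof -
  let ?F = "\<lambda>\<theta>. if m = 0 then complex_of_real \<theta> else cis (of_int m * \<theta>) / (\<i> * of_int m)"
  have D: "(?F has_vector_derivative cis (of_int m * \<theta>)) (at \<theta> within {0..2 * pi})" for \<theta>
  proof (cases "m = 0")
    case True
    then show ?thesis
      by (auto intro!: derivative_eq_intros)
  next
    case False
    then show ?thesis
      unfolding has_vector_derivative_def
      by (auto intro!: derivative_eq_intros simp: field_simps scaleR_conv_of_real)
  qed
  have "has_bochner_integral lborel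
          (\<lambda>\<theta>. indicator {0..2 * pi} \<theta> *\<^sub>R cis (of_int m * \<theta>)) (?F (2 * pi) - ?F 0)"
    by (rule has_bochner_integral_FTC_Icc) (auto intro!: D continuous_intros)
  moreover have "cis (of_int m * (2 * pi)) = 1"
    using cis_multiple_2pi[of "of_int m"] by (simp add: mult_ac)
  ultimately have I: "has_bochner_integral lborel
      (\<lambda>\<theta>. indicator {0..2 * pi} \<theta> *\<^sub>R cis (of_int m * \<theta>))
      (if m = 0 then complex_of_real (2 * pi) else 0)"
    by (simp split: if_splits)
  \<comment> \<open>The fundamental theorem covers the closed interval, while the circle is
    parametrized by the half-open one; they differ by the null set \<open>{2 * pi}\<close>.\<close>
  have "AE \<theta> in lborel. \<theta> \<noteq> 2 * pi"
    by (rule AE_lborel_singleton)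
  then have "AE \<theta> in lborel. indicator {0..2 * pi} \<theta> *\<^sub>R cis (of_int m * \<theta>)
      = indicator {0..<2 * pi} \<theta> *\<^sub>R cis (of_int m * \<theta>)"
    by eventually_elim (auto simp: indicator_def)
  with I have "has_bochner_integral lborel
      (\<lambda>\<theta>. indicator {0..<2 * pi} \<theta> *\<^sub>R cis (of_int m * \<theta>))
      (if m = 0 then complex_of_real (2 * pi) else 0)"
    by (subst (asm) has_bochner_integral_cong_AE)
       (auto intro!: borel_measurable_scaleR borel_measurable_indicator
          borel_measurable_continuous_onI[of "\<lambda>\<theta>. cis (of_int m * \<theta>)"] continuous_intros)
  then show ?thesis
    by (simp add: has_bochner_integral_restrict_space)
qed

text \<open>Euler's formula splits each cosine into two conjugate exponentials. Every frequency,
  even 0, is displayed as \<open>of_int k * \<theta>\<close> so that all terms have the shape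
  integrated in \<open>has_bochner_integral_cis\<close>.\<close>

lemma qc_pdf_eq_cis:
  "complex_of_real (qc_pdf \<mu>1 \<mu>2 r1 r2 \<theta>) =
     1 / of_real (2 * pi * (1 + r1\<^sup>2 + r2\<^sup>2)) *
     (of_real (1 + r1\<^sup>2 + r2\<^sup>2) * cis (of_int 0 * \<theta>)
      + of_real r1 * cis (- \<mu>1) * cis (of_int 1 * \<theta>)
      + of_real r1 * cis \<mu>1 * cis (of_int (-1) * \<theta>)
      + of_real r2 * cis (- \<mu>2) * cis (of_int 1 * \<theta>)
      + of_real r2 * cis \<mu>2 * cis (of_int (-1) * \<theta>)
      + of_real (r1 * r2) * cis (- \<mu>1 - \<mu>2) * cis (of_int 2 * \<theta>)
      + of_real (r1 * r2) * cis (\<mu>1 + \<mu>2) * cis (of_int (-2) * \<theta>))"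
proof -
  have E: "of_real c * cis (- a) * cis x + of_real c * cis a * cis (- x)
      = complex_of_real (2 * c * cos (x - a))" for c a x :: real
    by (simp add: complex_eq_iff cos_diff)
       (simp add: algebra_simps)
  show ?thesis
    using E[of r1 \<mu>1 \<theta>] E[of r2 \<mu>2 \<theta>] E[of "r1 * r2" "\<mu>1 + \<mu>2" "2 * \<theta>"]
    by (simp add: qc_pdf_def add.assoc diff_diff_eq)
qed

text \<open>Multiplying by the character of index \<open>n\<close> shifts each frequency
  \<open>k\<close> to \<open>k + n\<close>, and only terms of total frequency 0 contribute. The
  value is left unsimplified to mirror the expansion term by term; it serves both the total mass and
  the Fourier coefficients.\<close>

lemma has_bochner_integral_qc_pdf_cis:
  "has_bochner_integral (restrict_space lborel {0..<2 * pi})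
     (\<lambda>\<theta>. complex_of_real (qc_pdf \<mu>1 \<mu>2 r1 r2 \<theta>) * cis (of_int n * \<theta>))
     (1 / of_real (2 * pi * (1 + r1\<^sup>2 + r2\<^sup>2)) *
      (of_real (1 + r1\<^sup>2 + r2\<^sup>2) * (if 0 + n = 0 then complex_of_real (2 * pi) else 0)
       + of_real r1 * cis (- \<mu>1) * (if 1 + n = 0 then complex_of_real (2 * pi) else 0)
       + of_real r1 * cis \<mu>1 * (if -1 + n = 0 then complex_of_real (2 * pi) else 0)
       + of_real r2 * cis (- \<mu>2) * (if 1 + n = 0 then complex_of_real (2 * pi) else 0)
       + of_real r2 * cis \<mu>2 * (if -1 + n = 0 then complex_of_real (2 * pi) else 0)
       + of_real (r1 * r2) * cis (- \<mu>1 - \<mu>2) * (if 2 + n = 0 then complex_of_real (2 * pi) else 0)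
       + of_real (r1 * r2) * cis (\<mu>1 + \<mu>2) * (if -2 + n = 0 then complex_of_real (2 * pi) else 0)))"
proof -
  have shift: "cis (of_int k * \<theta>) * cis (of_int n * \<theta>) = cis (of_int (k + n) * \<theta>)" for k \<theta>
    by (simp add: cis_mult distrib_right)
  show ?thesis
    unfolding qc_pdf_eq_cis distrib_right mult.assoc shift
    unfolding distrib_left
    by (intro has_bochner_integral_add has_bochner_integral_mult_right has_bochner_integral_cis)
qed

lemma sets_quadratic_cardioid: "sets (quadratic_cardioid \<mu>1 \<mu>2 r1 r2) = sets borel"
  by (simp add: quadratic_cardioid_def circle_dtheta_def)

lemma prob_space_quadratic_cardioid: "prob_space (quadratic_cardioid \<mu>1 \<mu>2 r1 r2)"
proof (rule prob_spaceI)
  let ?M = "restrict_space lborel {0..<2 * pi}"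
  let ?f = "qc_pdf \<mu>1 \<mu>2 r1 r2"
  have "complex_of_real (1 + r1\<^sup>2 + r2\<^sup>2) \<noteq> 0"
    using qc_normalizer_pos[of r1 r2] by (simp only: of_real_eq_0_iff)
  \<comment> \<open>At \<open>n = 0\<close> only the constant term survives, and its integral
    cancels the normalizer.\<close>
  then have "has_bochner_integral ?M (\<lambda>\<theta>. complex_of_real (?f \<theta>)) (complex_of_real 1)"
    using has_bochner_integral_qc_pdf_cis[of \<mu>1 \<mu>2 r1 r2 0] by simp
  then have "has_bochner_integral ?M (\<lambda>\<theta>. Re (complex_of_real (?f \<theta>))) (Re (complex_of_real 1))"
    by (rule has_bochner_integral_bounded_linear[OF bounded_linear_Re])
  then have *: "integrable ?M ?f" "integral\<^sup>L ?M ?f = 1"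
    by (auto simp: has_bochner_integral_iff)
  have "emeasure (quadratic_cardioid \<mu>1 \<mu>2 r1 r2) (space (quadratic_cardioid \<mu>1 \<mu>2 r1 r2))
      = (\<integral>\<^sup>+ x. ennreal (qc_density \<mu>1 \<mu>2 r1 r2 x) \<partial>circle_dtheta)"
    by (simp add: quadratic_cardioid_def circle_dtheta_def emeasure_density)
  also have "\<dots> = (\<integral>\<^sup>+ \<theta>. ennreal (?f \<theta>) \<partial>?M)"
    unfolding circle_dtheta_def
    by (subst nn_integral_distr) (auto simp: qc_density.abs_eq intro!: measurable_restrict_space1)
  \<comment> \<open>Nonnegativity of the density lets the Lebesgue integral of
    \<open>ennreal (?f \<theta>)\<close> be read off from the Bochner integral.\<close>
  also have "\<dots> = ennreal 1"
    using * by (simp add: nn_integral_eq_integral qc_pdf_nonneg)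
  finally show "emeasure (quadratic_cardioid \<mu>1 \<mu>2 r1 r2)
      (space (quadratic_cardioid \<mu>1 \<mu>2 r1 r2)) = 1"
    by simp
qed

lemma qc_density_nonneg: "0 \<le> qc_density \<mu>1 \<mu>2 r1 r2 x"
  by transfer (rule qc_pdf_nonneg)

text \<open>The density becomes a real weight, being nonnegative, and the image measure is pulled
  back along \<open>abs_circle\<close> to the interval.\<close>

lemma fourier_coeff_quadratic_cardioid:
  "fourier_coeff (quadratic_cardioid \<mu>1 \<mu>2 r1 r2) n =
     (LINT \<theta>|restrict_space lborel {0..<2 * pi}.
        complex_of_real (qc_pdf \<mu>1 \<mu>2 r1 r2 \<theta>) * cis (of_int (- n) * \<theta>))"
proof -
  have "fourier_coeff (quadratic_cardioid \<mu>1 \<mu>2 r1 r2) n =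
      (LINT x|circle_dtheta. qc_density \<mu>1 \<mu>2 r1 r2 x *\<^sub>R circle_char (- n) x)"
    unfolding fourier_coeff_def quadratic_cardioid_def
    by (rule integral_density) (auto simp: circle_dtheta_def qc_density_nonneg)
  also have "\<dots> = (LINT \<theta>|restrict_space lborel {0..<2 * pi}.
      qc_pdf \<mu>1 \<mu>2 r1 r2 \<theta> *\<^sub>R cis (of_int (- n) * \<theta>))"
    unfolding circle_dtheta_def
    by (subst integral_distr)
       (auto simp: qc_density.abs_eq circle_char_abs intro!: measurable_restrict_space1)
  finally show ?thesis
    by (simp add: scaleR_conv_of_real)
qed

theorem proposition5: "QC \<subseteq> T2"
proof -
  have "fourier_coeff (quadratic_cardioid \<mu>1 \<mu>2 r1 r2) n = 0"
    if "n \<notin> {-2, -1, 0, 1, 2}" for \<mu>1 \<mu>2 r1 r2 n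
    \<comment> \<open>A frequency \<open>k\<close> in the expansion contributes only if
      \<open>k - n = 0\<close>; as \<open>k\<close> ranges over -2 to 2, every term vanishes for the
      excluded \<open>n\<close>.\<close>
    unfolding fourier_coeff_quadratic_cardioid
      has_bochner_integral_integral_eq[OF has_bochner_integral_qc_pdf_cis]
    using that by (auto split: if_splits)
  then have "quadratic_cardioid \<mu>1 \<mu>2 r1 r2 \<in> T2" for \<mu>1 \<mu>2 r1 r2
    unfolding T2_def mem_Collect_eq
    by (intro conjI allI impI sets_quadratic_cardioid prob_space_quadratic_cardioid)
  then show ?thesis
    unfolding QC_def by blast
qed

end
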